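(* Let $N, S$ be positive integers and let $Q_{\mathrm{Chol}}(N,S)$ be the minimum number of I/O operations (element transfers between slow and fast memory), over all schedules of the classical three-nested-loops Cholesky factorization algorithm of an $N\times N$ symmetric positive definite matrix $\mathbf{A}$, on a machine with a fast memory of size $S$. Then $$Q_{\mathrm{Chol}}(N, S) \geqslant \frac{1}{3\sqrt{2}}\, \frac{N^{3}}{\sqrt{S}}.$$
   Context: Machine model: there is a slow memory of unbounded size, which initially holds all the data, and a fast memory that can hold at most $S$ matrix elements. An elementary operation can be performed only if all its operands are in fast memory. The schedule explicitly controls which elements are loaded into and removed from the fast memory. An I/O operation (data access) is the transfer of one element between slow and fast memory. Cholesky algorithm (in place; only the lower triangular part is referenced; it replaces $\mathbf{A}$ by the lower triangular $\mathbf{L}$ with $\mathbf{A}=\mathbf{L}\cdot\mathbf{L}^{\mathsf T}$): for $k=1,\dots,N$, do $\mathbf{A}_{k,k}=\sqrt{\mathbf{A}_{k,k}}$; then for $i=k+1,\dots,N$, do $\mathbf{A}_{i,k}=\mathbf{A}_{i,k}/\mathbf{A}_{k,k}$, and for $j=k+1,\dots,i$, do the update operation $\mathbf{A}_{i,j} \mathrel{-}= \mathbf{A}_{i,k}\cdot\mathbf{A}_{j,k}$. The operands of the update operation $(i,j,k)$ are $\mathbf{A}_{i,j},\mathbf{A}_{i,k},\mathbf{A}_{j,k}$. The set of operations is fixed. A schedule is an ordering of these operations respecting the data dependencies, together with the loads and removals of elements in fast memory. *)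

theory Defs
  imports Complex_Main "HOL-Library.Extended_Real" "HOL-Library.Extended_Nat"
begin

(* Entry (i, j) of the lower triangle, 1 <= j <= i <= N; rows and columns are counted from 1. *)
type_synonym elem = "nat \<times> nat"

datatype chol_op =
    Sqrt nat             (* Sqrt k:       A(k,k) := sqrt A(k,k) *)
  | Div nat nat          (* Div i k:      A(i,k) := A(i,k) / A(k,k) *)
  | Update nat nat nat   (* Update i j k: A(i,j) := A(i,j) - A(i,k) * A(j,k) *)

fun operands :: "chol_op \<Rightarrow> elem set" where
  "operands (Sqrt k) = {(k, k)}"
| "operands (Div i k) = {(i, k), (k, k)}"
| "operands (Update i j k) = {(i, j), (i, k), (j, k)}"

fun target :: "chol_op \<Rightarrow> elem" where
  "target (Sqrt k) = (k, k)"
| "target (Div i k) = (i, k)"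
| "target (Update i j k) = (i, j)"

definition chol_ops :: "nat \<Rightarrow> chol_op set" where
  "chol_ops N =
     {Sqrt k | k. 1 \<le> k \<and> k \<le> N}
   \<union> {Div i k | i k. 1 \<le> k \<and> k < i \<and> i \<le> N}
   \<union> {Update i j k | i j k. 1 \<le> k \<and> k < j \<and> j \<le> i \<and> i \<le> N}"

(* depends a b: operation b needs the result of a.  The updates of one entry (i, j) for
   different k are subtractions that commute, so no order is imposed among them; any other two
   operations one of which writes an entry accessed by the other are ordered by the transitive
   closure of this relation, as in the three nested loops. *)
inductive depends :: "chol_op \<Rightarrow> chol_op \<Rightarrow> bool" where
  "depends (Sqrt k) (Div i k)"
| "depends (Div i k) (Update i j k)"
| "depends (Div j k) (Update i j k)"
| "depends (Update i j k) (Div i j)"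
| "depends (Update j j k) (Sqrt j)"

datatype instr = Load elem | Store elem | Remove elem | Compute chol_op

(* A state (F, D) consists of the set F of entries held in fast memory and the set D of entries
   whose copy in slow memory is out of date.  Removing an entry is not a transfer, so an entry
   of D that is removed without having been stored is lost: it can no longer be loaded. *)
type_synonym mem_state = "elem set \<times> elem set"

inductive step :: "nat \<Rightarrow> mem_state \<Rightarrow> instr \<Rightarrow> mem_state \<Rightarrow> bool" for S :: nat where
  load: "\<lbrakk>e \<notin> D; card (insert e F) \<le> S\<rbrakk> \<Longrightarrow> step S (F, D) (Load e) (insert e F, D)"
| store: "e \<in> F \<Longrightarrow> step S (F, D) (Store e) (F, D - {e})"
| remove: "e \<in> F \<Longrightarrow> step S (F, D) (Remove e) (F - {e}, D)"
| compute: "operands a \<subseteq> F \<Longrightarrow> step S (F, D) (Compute a) (F, insert (target a) D)"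

inductive exec :: "nat \<Rightarrow> mem_state \<Rightarrow> instr list \<Rightarrow> mem_state \<Rightarrow> bool" for S :: nat where
  Nil: "exec S s [] s"
| Cons: "\<lbrakk>step S s x s'; exec S s' xs s''\<rbrakk> \<Longrightarrow> exec S s (x # xs) s''"

fun computed :: "instr list \<Rightarrow> chol_op list" where
  "computed [] = []"
| "computed (Compute a # xs) = a # computed xs"
| "computed (x # xs) = computed xs"

(* Fast memory is initially empty, and at the end slow memory holds the current value of every
   entry, that is, A has been replaced by L there. *)
definition chol_schedule :: "nat \<Rightarrow> nat \<Rightarrow> instr list \<Rightarrow> bool" where
  "chol_schedule N S p \<longleftrightarrow>
     distinct (computed p) \<and> set (computed p) = chol_ops N \<and>
     sorted_wrt (\<lambda>a b. \<not> depends b a) (computed p) \<and>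
     (\<exists>F. exec S ({}, {}) p (F, {}))"

fun is_io :: "instr \<Rightarrow> bool" where
  "is_io (Load e) = True"
| "is_io (Store e) = True"
| "is_io (Remove e) = False"
| "is_io (Compute a) = False"

definition io_count :: "instr list \<Rightarrow> nat" where
  "io_count p = length (filter is_io p)"

(* A minimum over the extended naturals: it is attained whenever a schedule exists, and is
   infinite if S is too small for the operands of some operation.  The values of the positive
   definite matrix A do not occur: the set of operations and their dependencies are fixed by N. *)
definition Q_Chol :: "nat \<Rightarrow> nat \<Rightarrow> enat" where
  "Q_Chol N S = (INF p \<in> {p. chol_schedule N S p}. enat (io_count p))"

end

theory Submission
  imports Defs
begin

text \<open>Only the updates \<open>(i, j, k)\<close> with \<open>k < j < i\<close> are counted. A set of them with \<open>g (2 g + 1)\<close>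
  targets and \<open>a\<close> factors has at most \<open>g a\<close> elements: for each \<open>k\<close>, if \<open>n\<close> factors are in column \<open>k\<close>,
  the number of updates is at most both \<open>n (n - 1) / 2\<close> and the number of targets.

  In Cholesky, unlike in the rank-\<open>k\<close> update, targets and factors share one array. But an entry that
  plays both roles in one phase of the schedule is divided in that phase, and each entry is divided
  only once. So phases are cut by charging the off-diagonal loads and these divisions, and a phase
  of charge \<open>2 S\<close> has at most \<open>3 S\<close> targets and factors in total. With \<open>s = sqrt (S / 2)\<close> it
  performs at most \<open>(s - 1/6) 2 S\<close> updates. The incomplete phase comes first, where the memory
  is empty, and satisfies the same rate.

  The final stores pay for the charged divisions. The stores and diagonal loads left over, \<open>3 N - 1\<close>
  in number, together with the gain \<open>1/6\<close> in the rate, pay for the updates of lower order that are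
  missing from \<open>N\<^sup>3 / 6\<close>.\<close>

section \<open>Counting updates by their targets and factors\<close>

lemma card_pairs_less:
  fixes E :: "(nat \<times> nat) set"
  assumes "finite V" and "\<And>i j. (i, j) \<in> E \<Longrightarrow> i \<in> V \<and> j \<in> V \<and> j < i"
  shows "2 * real (card E) \<le> real (card V) * (real (card V) - 1)"
proof -
  have sub: "E \<subseteq> V \<times> V"
    using assms(2) by auto
  have finE: "finite E"
    using sub assms(1) by (meson finite_SigmaI finite_subset)
  \<comment> \<open>\<open>E\<close>, its mirror image and the diagonal are pairwise disjoint inside
    the square of \<open>V\<close>.\<close>
  have "card (E \<union> prod.swap ` E \<union> (\<lambda>v. (v, v)) ` V) \<le> card (V \<times> V)"
    using assms by (intro card_mono) auto
  moreover have "card (E \<union> prod.swap ` E \<union> (\<lambda>v. (v, v)) ` V)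
      = card E + card (prod.swap ` E) + card ((\<lambda>v. (v, v)) ` V)"
  proof -
    have "E \<inter> prod.swap ` E = {}" "(E \<union> prod.swap ` E) \<inter> (\<lambda>v. (v, v)) ` V = {}"
      using assms(2) by (auto, (meson less_asym less_irrefl)+)
    then show ?thesis
      using finE assms(1) by (simp add: card_Un_disjoint)
  qed
  moreover have "card (prod.swap ` E) = card E" "card ((\<lambda>v. (v, v)) ` V) = card V"
    by (auto intro!: card_image inj_onI)
  ultimately have "2 * card E + card V \<le> card V * card V"
    by (simp add: card_cartesian_product)
  then have "2 * real (card E) + real (card V) \<le> real (card V) * real (card V)"
    by (metis of_nat_add of_nat_le_iff of_nat_mult of_nat_numeral)
  then show ?thesis
    by (simp add: algebra_simps)
qed

text \<open>Slice by \<open>k\<close> and let n be the size of \<open>V k\<close>. The bounds n (n -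
  1) / 2 and g (2 g + 1) on a slice both equal g n at n = 2 g + 1. Up to there the first is at most
  g n, beyond it the second is.\<close>

lemma card_triples_le:
  fixes B :: "(nat \<times> nat \<times> nat) set"
  assumes finB: "finite B" and less: "\<And>i j k. (i, j, k) \<in> B \<Longrightarrow> j < i"
    and g: "g \<ge> 0" and C: "real (card ((\<lambda>(i, j, k). (i, j)) ` B)) \<le> g * (2 * g + 1)"
  shows "real (card B)
    \<le> g * real (card ((\<lambda>(i, j, k). (i, k)) ` B \<union> (\<lambda>(i, j, k). (j, k)) ` B))" (is "_ \<le> g * real (card ?A)")
proof -
  define K where "K = (\<lambda>(i, j, k). k) ` B"
  define E where "E = (\<lambda>k. {(i, j). (i, j, k) \<in> B})"
  define V where "V = (\<lambda>k. {v. (v, k) \<in> ?A})"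
  have finA: "finite ?A" and finK: "finite K"
    using finB by (auto simp: K_def)
  have finE: "finite (E k)" for k
    by (rule finite_subset[OF _ finite_imageI[OF finB, of "\<lambda>(i, j, k). (i, j)"]])
      (force simp: E_def)
  have finV: "finite (V k)" for k
    by (rule finite_subset[OF _ finite_imageI[OF finA, of fst]]) (force simp: V_def)
  have "card B = card (SIGMA k:K. E k)"
    by (rule bij_betw_same_card[of "\<lambda>(i, j, k). (k, i, j)"])
      (force simp: bij_betw_def inj_on_def K_def E_def)
  also have "\<dots> = (\<Sum>k\<in>K. card (E k))"
    using finK finE by simp
  finally have B: "card B = (\<Sum>k\<in>K. card (E k))" .
  have "card ?A = card (SIGMA k:K. V k)"
    by (rule bij_betw_same_card[of prod.swap]) (force simp: bij_betw_def inj_on_def K_def V_def)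
  also have "\<dots> = (\<Sum>k\<in>K. card (V k))"
    using finK finV by simp
  finally have A: "card ?A = (\<Sum>k\<in>K. card (V k))" .
  have "real (card (E k)) \<le> g * real (card (V k))" for k
  proof (cases "real (card (V k)) - 1 \<le> 2 * g")
    case True
    have "2 * real (card (E k)) \<le> real (card (V k)) * (real (card (V k)) - 1)"
      using less by (intro card_pairs_less finV) (force simp: E_def V_def)
    also have "\<dots> \<le> real (card (V k)) * (2 * g)"
      using True by (intro mult_left_mono) auto
    finally show ?thesis
      by (simp add: mult.commute)
  next
    case False
    have "card (E k) \<le> card ((\<lambda>(i, j, k). (i, j)) ` B)"
      using finB by (intro card_mono) (force simp: E_def)+
    then have "real (card (E k)) \<le> g * (2 * g + 1)"
      using C by linarith
    also have "\<dots> \<le> g * real (card (V k))"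
      using False g by (intro mult_left_mono) auto
    finally show ?thesis .
  qed
  then show ?thesis
    unfolding A B of_nat_sum sum_distrib_left by (intro sum_mono)
qed

section \<open>Cubic inequalities behind the rate of a phase\<close>

text \<open>With S = 2 s^2, the budget 3 S for targets and factors is 6 s^2 and the charge 2 S is 4
  s^2. Subtracting the g (2 g + 1) targets from the budget leaves the factors.\<close>

lemma phase_cubic:
  fixes g s :: real
  assumes "g \<ge> 0" and "s \<ge> 1 / 2"
  shows "g * (6 * s^2 - g * (2 * g + 1)) \<le> (s - 1/6) * (4 * s^2)"
proof -
  \<comment> \<open>Up to the lower-order term -g^2, the left side is maximal at
    \<open>g = s\<close>, so it is expanded there.\<close>
  define v where "v = g - s"
  have "4 * s * v^2 = 2 * v^2 * (2 * s)"
    by simp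
  also have "\<dots> \<le> 2 * v^2 * (3 * s + v)"
    using assms by (intro mult_left_mono) (auto simp: v_def)
  finally have "4 * s * v^2 \<le> 2 * v^2 * (3 * s + v)" .
  moreover have "2 * v^2 \<le> 4 * s * v^2"
    using assms by (simp add: mult_right_mono)
  moreover have "0 \<le> (3 * v + s)^2 / 3"
    by simp
  \<comment> \<open>The constant 1/6 in the rate leaves the term s^2 / 3, which completes this
    square exactly.\<close>
  then have "0 \<le> 3 * v^2 + 2 * s * v + s^2 / 3"
    by (simp add: power2_eq_square algebra_simps)
  ultimately have "0 \<le> 2 * v^2 * (3 * s + v) + v^2 + 2 * s * v + s^2 / 3"
    by linarith
  also have "\<dots> = (s - 1/6) * (4 * s^2) - g * (6 * s^2 - g * (2 * g + 1))"
    by (simp add: v_def power2_eq_square algebra_simps)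
  finally show ?thesis by simp
qed

text \<open>The difference of the sides is linear in \<open>r\<close>. If \<open>g\<close> exceeds
  the rate, the worst case is r = 4 s^2, which follows from the previous bound with its larger
  budget 6 s^2.\<close>

lemma phase_cubic_start:
  fixes g s r :: real
  assumes "g \<ge> 0" and "s \<ge> 1 / 2" and "0 \<le> r" "r \<le> 4 * s^2"
  shows "g * (r - g * (2 * g + 1)) \<le> (s - 1/6) * r"
proof (cases "g \<le> s - 1/6")
  case True
  then have "g * r \<le> (s - 1/6) * r"
    using assms by (intro mult_right_mono) auto
  moreover have "0 \<le> g * (g * (2 * g + 1))"
    using assms by simp
  ultimately show ?thesis
    by (simp add: right_diff_distrib)
next
  case False
  then have "(g - (s - 1/6)) * r \<le> (g - (s - 1/6)) * (4 * s^2)"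
    using assms by (intro mult_left_mono) auto
  moreover have "0 \<le> g * (2 * s^2)"
    using assms by simp
  ultimately show ?thesis
    using phase_cubic[OF assms(1,2)] by (simp add: algebra_simps)
qed

section \<open>Executions: memory contents, forced loads and stores\<close>

lemma computed_append [simp]: "computed (p @ q) = computed p @ computed q"
  by (induction p rule: computed.induct) auto

lemma exec_Nil_iff [simp]: "exec S s [] s' \<longleftrightarrow> s' = s"
  by (subst exec.simps) auto

lemma exec_Cons_iff [simp]:
  "exec S s (x # p) s'' \<longleftrightarrow> (\<exists>s'. step S s x s' \<and> exec S s' p s'')"
  by (subst exec.simps) auto

lemma exec_append [simp]:
  "exec S s (p @ q) s'' \<longleftrightarrow> (\<exists>s'. exec S s p s' \<and> exec S s' q s'')"
  by (induction p arbitrary: s) (simp, simp, blast)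

lemma exec_memory_bound:
  assumes "exec S (F, D) p (F', D')" and "finite F" "card F \<le> S"
  shows "finite F' \<and> card F' \<le> S"
  using assms
proof (induction "(F, D)" p "(F', D')" arbitrary: F D rule: exec.induct)
  case (Cons x s' xs F D)
  then show ?case
    by (cases s') (auto elim!: step.cases intro: le_trans[OF card_Diff1_le])
qed auto

lemma exec_operand_loaded:
  assumes "exec S (F, D) p (F', D')" and "a \<in> set (computed p)" "e \<in> operands a"
  shows "e \<in> F \<or> Load e \<in> set p"
  using assms
proof (induction "(F, D)" p "(F', D')" arbitrary: F D rule: exec.induct)
  case (Cons x s' xs F D)
  then show ?case
    by (cases s') (auto elim!: step.cases)
qed auto

text \<open>Only a \<open>Store\<close> takes an entry out of \<open>D\<close>; a removal leaves it
  there. Hence a clean final state forces a store of every target.\<close>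

lemma exec_target_stored:
  assumes "exec S (F, D) p (F', D')" and "e \<in> D \<union> target ` set (computed p)" "e \<notin> D'"
  shows "Store e \<in> set p"
  using assms
proof (induction "(F, D)" p "(F', D')" arbitrary: F D rule: exec.induct)
  case (Cons x s' xs F D)
  then show ?case
    by (cases s') (auto elim!: step.cases)
qed auto

text \<open>Used to cut a schedule into phases of prescribed charge.\<close>

lemma filter_split:
  "length (filter P xs) = a + b \<Longrightarrow>
    \<exists>ys zs. xs = ys @ zs \<and> length (filter P ys) = a \<and> length (filter P zs) = b"
proof (induction xs arbitrary: a)
  case (Cons x xs)
  show ?case
  proof (cases "a = 0")
    case True
    then show ?thesis
      using Cons.prems by (intro exI[of _ "[]"] exI[of _ "x # xs"]) auto
  next
    case False
    define a' where "a' = (if P x then a - 1 else a)"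
    have "length (filter P xs) = a' + b"
      using Cons.prems False by (auto simp: a'_def split: if_splits)
    from Cons.IH[OF this] obtain ys zs where
      "xs = ys @ zs" "length (filter P ys) = a'" "length (filter P zs) = b" by blast
    then show ?thesis
      using False by (intro exI[of _ "x # ys"] exI[of _ zs]) (auto simp: a'_def)
  qed
qed simp

section \<open>Charged instructions and segments of a schedule\<close>

text \<open>Updates with k < j < i touch no diagonal entry, so diagonal loads are free. Column 1
  contains no target of an update, so its divisions are free too.\<close>

fun charged :: "instr \<Rightarrow> bool" where
  "charged (Load e) = (fst e \<noteq> snd e)"
| "charged (Compute (Div i k)) = (2 \<le> k)"
| "charged _ = False"

definition charge :: "instr list \<Rightarrow> nat" where
  "charge p = length (filter charged p)"

definition updates :: "instr list \<Rightarrow> (nat \<times> nat \<times> nat) set" where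
  "updates p = {(i, j, k). Update i j k \<in> set (computed p) \<and> j < i}"

lemma charge_append [simp]: "charge (p @ q) = charge p + charge q"
  by (simp add: charge_def)

lemma updates_append [simp]: "updates (p @ q) = updates p \<union> updates q"
  by (auto simp: updates_def)

lemma finite_updates [simp]: "finite (updates p)"
proof -
  have "updates p \<subseteq> (\<lambda>a. case a of Update i j k \<Rightarrow> (i, j, k)) ` set (computed p)"
    by (force simp: updates_def)
  then show ?thesis
    by (rule finite_subset) simp
qed

lemma set_computed: "a \<in> set (computed p) \<longleftrightarrow> Compute a \<in> set p"
  by (induction p rule: computed.induct) auto

text \<open>The surroundings \<open>pre\<close> and \<open>post\<close> make the order of the whole
  schedule available within a phase.\<close>

definition segment :: "nat \<Rightarrow> instr list \<Rightarrow> bool" where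
  "segment N p \<longleftrightarrow> (\<exists>pre post.
     set (computed (pre @ p @ post)) = chol_ops N \<and>
     sorted_wrt (\<lambda>a b. \<not> depends b a) (computed (pre @ p @ post)))"

lemma segment_append:
  assumes "segment N (p @ q)"
  shows "segment N p" "segment N q"
proof -
  obtain pre post where *:
    "set (computed (pre @ (p @ q) @ post)) = chol_ops N"
    "sorted_wrt (\<lambda>a b. \<not> depends b a) (computed (pre @ (p @ q) @ post))"
    using assms unfolding segment_def by blast
  show "segment N p"
    unfolding segment_def using * by (intro exI[of _ pre] exI[of _ "q @ post"]) simp
  show "segment N q"
    unfolding segment_def using * by (intro exI[of _ "pre @ p"] exI[of _ post]) simp
qed

text \<open>The division of (i, j) comes after every update of (i, j) and before every use of the
  result. With one of each in \<open>p\<close>, it lies neither before nor after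
  \<open>p\<close>.\<close>

lemma segment_Div:
  assumes "segment N p" and upd: "Update i j k \<in> set (computed p)" and "j < i"
    and use: "a \<in> set (computed p)" "depends (Div i j) a"
  shows "Div i j \<in> set (computed p) \<and> 2 \<le> j"
proof -
  obtain pre post where ops: "set (computed (pre @ p @ post)) = chol_ops N"
    and srt: "sorted_wrt (\<lambda>a b. \<not> depends b a) (computed (pre @ p @ post))"
    using assms(1) unfolding segment_def by blast
  have "Update i j k \<in> chol_ops N"
    using upd ops by auto
  then have "1 \<le> k" "k < j" "i \<le> N"
    by (auto simp: chol_ops_def)
  then have "Div i j \<in> set (computed (pre @ p @ post))"
    using \<open>j < i\<close> unfolding ops by (auto simp: chol_ops_def)
  moreover have "Div i j \<notin> set (computed pre)" "Div i j \<notin> set (computed post)"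
    using srt upd use depends.intros(4)[of i j k] by (auto simp: sorted_wrt_append)
  ultimately show ?thesis
    using \<open>1 \<le> k\<close> \<open>k < j\<close> by auto
qed

text \<open>Inclusion-exclusion: the union of targets and factors lies in \<open>F\<close> and the
  loaded entries \<open>L\<close>, the intersection in the divided entries \<open>Q\<close>.
  \<open>L\<close> and \<open>Q\<close> give distinct charged instructions.\<close>

lemma segment_entries:
  assumes ex: "exec S (F, D) p s" and "finite F" and seg: "segment N p"
  defines "C \<equiv> (\<lambda>(i, j, k). (i, j)) ` updates p"
    and "A \<equiv> (\<lambda>(i, j, k). (i, k)) ` updates p \<union> (\<lambda>(i, j, k). (j, k)) ` updates p"
  shows "card C + card A \<le> card F + charge p"
proof -
  define L where "L = {e. Load e \<in> set p \<and> fst e \<noteq> snd e}"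
  define Q where "Q = {(i, k). Compute (Div i k) \<in> set p \<and> 2 \<le> k}"
  have range: "k < j \<and> j < i" if "(i, j, k) \<in> updates p" for i j k
  proof -
    have "Update i j k \<in> chol_ops N"
      using that seg by (auto simp: updates_def segment_def)
    then show ?thesis
      using that by (auto simp: chol_ops_def updates_def)
  qed
  have fin: "finite C" "finite A"
    by (auto simp: C_def A_def)
  have LQ: "Load ` L \<union> (\<lambda>(i, k). Compute (Div i k)) ` Q \<subseteq> set (filter charged p)"
    by (auto simp: L_def Q_def)
  have finL: "finite L"
    by (rule inj_on_finite[of Load _ "set p"]) (auto simp: L_def inj_on_def)
  have finQ: "finite Q"
    by (rule inj_on_finite[of "\<lambda>(i, k). Compute (Div i k)" _ "set p"])
      (auto simp: Q_def inj_on_def)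
  have "card L + card Q = card (Load ` L \<union> (\<lambda>(i, k). Compute (Div i k)) ` Q)"
  proof -
    have "card (Load ` L) = card L" "card ((\<lambda>(i, k). Compute (Div i k)) ` Q) = card Q"
      by (auto intro!: card_image inj_onI)
    then show ?thesis
      using finL finQ by (subst card_Un_disjoint) auto
  qed
  also have "\<dots> \<le> card (set (filter charged p))"
    using LQ by (intro card_mono) auto
  also have "\<dots> \<le> charge p"
    unfolding charge_def by (rule card_length)
  finally have LQ': "card L + card Q \<le> charge p" .
  have entry: "\<exists>i j k. (i, j, k) \<in> updates p \<and> e \<in> {(i, j), (i, k), (j, k)}"
    if "e \<in> C \<union> A" for e
    using that unfolding C_def A_def by auto blast
  have "e \<in> F \<or> Load e \<in> set p" if e: "e \<in> C \<union> A" for e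
  proof -
    obtain i j k where "Update i j k \<in> set (computed p)" "e \<in> operands (Update i j k)"
      using entry[OF e] by (auto simp: updates_def)
    moreover obtain F' D' where "s = (F', D')"
      by fastforce
    ultimately show ?thesis
      using exec_operand_loaded ex by blast
  qed
  moreover have "fst e \<noteq> snd e" if "e \<in> C \<union> A" for e
    using entry[OF that] range by fastforce
  ultimately have "C \<union> A \<subseteq> F \<union> L"
    by (auto simp: L_def)
  then have "card (C \<union> A) \<le> card F + card L"
    using \<open>finite F\<close> finL by (meson card_mono card_Un_le finite_UnI le_trans)
  moreover have "C \<inter> A \<subseteq> Q"
  proof
    fix e assume "e \<in> C \<inter> A"
    then obtain i j k where e: "e = (i, j)" "Update i j k \<in> set (computed p)" "j < i"
      by (auto simp: C_def updates_def)
    obtain i' j' k' where u: "(i', j', k') \<in> updates p" "e = (i', k') \<or> e = (j', k')"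
      using \<open>e \<in> C \<inter> A\<close> by (auto simp: A_def)
    then have "depends (Div i j) (Update i' j' k')" "Update i' j' k' \<in> set (computed p)"
      using e by (auto simp: updates_def intro: depends.intros)
    from segment_Div[OF seg e(2,3) this(2,1)] show "e \<in> Q"
      by (simp add: Q_def e set_computed)
  qed
  then have "card (C \<inter> A) \<le> card Q"
    using finQ by (rule card_mono[rotated])
  ultimately show ?thesis
    using card_Un_Int[OF fin] LQ' by linarith
qed

lemma segment_updates:
  assumes "exec S (F, D) p s" and "finite F" and "segment N p"
  obtains g where "g \<ge> 0"
    "real (card (updates p)) \<le> g * (real (card F + charge p) - g * (2 * g + 1))"
proof -
  let ?C = "(\<lambda>(i, j, k). (i, j)) ` updates p"
  let ?A = "(\<lambda>(i, j, k). (i, k)) ` updates p \<union> (\<lambda>(i, j, k). (j, k)) ` updates p"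
  define c where "c = real (card ?C)"
  \<comment> \<open>The nonnegative root of g (2 g + 1) = c.\<close>
  define g where "g = (sqrt (1 + 8 * c) - 1) / 4"
  have g: "g \<ge> 0"
    by (simp add: g_def c_def)
  have "4 * g + 1 = sqrt (1 + 8 * c)"
    by (simp add: g_def field_simps)
  then have "(4 * g + 1)^2 = 1 + 8 * c"
    by (simp add: c_def)
  then have C: "real (card ?C) = g * (2 * g + 1)"
    unfolding c_def by (simp add: power2_eq_square algebra_simps)
  have less: "j < i" if "(i, j, k) \<in> updates p" for i j k
    using that by (simp add: updates_def)
  have "real (card (updates p)) \<le> g * real (card ?A)"
    using g C by (intro card_triples_le less) auto
  also have "real (card ?A) \<le> real (card F + charge p) - g * (2 * g + 1)"
    using segment_entries[OF assms] C by linarith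
  then have "g * real (card ?A) \<le> g * (real (card F + charge p) - g * (2 * g + 1))"
    using g by (rule mult_left_mono)
  finally show ?thesis
    using that g by blast
qed

section \<open>Updates per phase and in the whole schedule\<close>

lemma phase_updates:
  fixes s :: real
  assumes s: "s \<ge> 1 / 2" "real S = 2 * s^2"
    and ex: "exec S (F, D) p \<sigma>" and F: "finite F" "card F \<le> S"
    and seg: "segment N p" and c: "charge p = 2 * S"
  shows "real (card (updates p)) \<le> (s - 1/6) * real (charge p)"
proof -
  obtain g where g: "g \<ge> 0"
    "real (card (updates p)) \<le> g * (real (card F + charge p) - g * (2 * g + 1))"
    using segment_updates[OF ex F(1) seg] by metis
  \<comment> \<open>At most S entries are inherited from the previous phase, and the charge adds 2
    S.\<close>
  have X: "real (card F + charge p) \<le> 6 * s^2" and c': "real (charge p) = 4 * s^2"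
    using F c s(2) by auto
  note g(2)
  also have "g * (real (card F + charge p) - g * (2 * g + 1)) \<le> g * (6 * s^2 - g * (2 * g + 1))"
    using X g(1) by (intro mult_left_mono) auto
  also have "\<dots> \<le> (s - 1/6) * (4 * s^2)"
    using g(1) s(1) by (rule phase_cubic)
  finally show ?thesis
    unfolding c' .
qed

lemma start_updates:
  fixes s :: real
  assumes s: "s \<ge> 1 / 2" "real S = 2 * s^2"
    and ex: "exec S ({}, D) p \<sigma>" and seg: "segment N p" and c: "charge p \<le> 2 * S"
  shows "real (card (updates p)) \<le> (s - 1/6) * real (charge p)"
proof -
  obtain g where g: "g \<ge> 0"
    "real (card (updates p)) \<le> g * (real (charge p) - g * (2 * g + 1))"
    using segment_updates[OF ex _ seg] by auto
  note g(2)
  also have "real (charge p) \<le> 4 * s^2"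
    using c s(2) by linarith
  then have "g * (real (charge p) - g * (2 * g + 1)) \<le> (s - 1/6) * real (charge p)"
    using g(1) s(1) by (intro phase_cubic_start) auto
  finally show ?thesis .
qed

text \<open>The number of phases is \<open>Suc q\<close>, since with charge 0 a nonempty memory
  could still allow updates.\<close>

lemma phases_updates:
  fixes s :: real
  assumes s: "s \<ge> 1 / 2" "real S = 2 * s^2"
    and "exec S (F, D) p \<sigma>" "finite F" "card F \<le> S" "segment N p" "charge p = Suc q * (2 * S)"
  shows "real (card (updates p)) \<le> (s - 1/6) * real (charge p)"
  using assms(3-)
proof (induction q arbitrary: F D p)
  case 0
  then show ?case
    using phase_updates[OF s] by simp
next
  case (Suc q)
  have "length (filter charged p) = Suc 0 * (2 * S) + Suc q * (2 * S)"
    using Suc.prems(5) by (simp add: charge_def)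
  then obtain p1 p2 where p: "p = p1 @ p2"
    and c: "charge p1 = Suc 0 * (2 * S)" "charge p2 = Suc q * (2 * S)"
    unfolding charge_def using filter_split by blast
  obtain F' D' where ex: "exec S (F, D) p1 (F', D')" "exec S (F', D') p2 \<sigma>"
    using Suc.prems(1) unfolding p by auto
  have F': "finite F'" "card F' \<le> S"
    using exec_memory_bound[OF ex(1) Suc.prems(2,3)] by auto
  have seg: "segment N p1" "segment N p2"
    using segment_append Suc.prems(4) unfolding p by blast+
  have "real (card (updates p1)) \<le> (s - 1/6) * real (charge p1)"
    using phase_updates[OF s ex(1) Suc.prems(2,3) seg(1)] c(1) by simp
  moreover have "real (card (updates p2)) \<le> (s - 1/6) * real (charge p2)"
    by (rule Suc.IH[OF ex(2) F' seg(2) c(2)])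
  moreover have "card (updates p) \<le> card (updates p1) + card (updates p2)"
    unfolding p by (simp add: card_Un_le)
  ultimately show ?case
    unfolding p by (simp add: distrib_left)
qed

lemma schedule_updates:
  fixes s :: real
  assumes s: "s \<ge> 1 / 2" "real S = 2 * s^2" and sched: "chol_schedule N S p"
  shows "real (card (updates p)) \<le> (s - 1/6) * real (charge p)"
proof -
  obtain F where ex: "exec S ({}, {}) p (F, {})"
    using sched by (auto simp: chol_schedule_def)
  have seg: "segment N p"
    unfolding segment_def using sched
    by (intro exI[of _ "[]"]) (auto simp: chol_schedule_def)
  have "S > 0"
    using s by (cases "S = 0") auto
  \<comment> \<open>The remainder \<open>r\<close> is cut off at the front, where the memory is
    empty.\<close>
  define r q where "r = charge p mod (2 * S)" and "q = charge p div (2 * S)"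
  have rq: "charge p = r + q * (2 * S)"
    unfolding r_def q_def by (rule mod_div_mult_eq[symmetric])
  have r: "r \<le> 2 * S"
    using \<open>S > 0\<close> by (simp add: r_def)
  show ?thesis
  proof (cases q)
    case 0
    then show ?thesis
      using start_updates[OF s ex seg] rq r by simp
  next
    case (Suc q')
    obtain p1 p2 where p: "p = p1 @ p2" and c: "charge p1 = r" "charge p2 = Suc q' * (2 * S)"
      using filter_split[of charged p r "Suc q' * (2 * S)"] rq unfolding Suc charge_def by blast
    obtain F' D' where ex': "exec S ({}, {}) p1 (F', D')" "exec S (F', D') p2 (F, {})"
      using ex unfolding p by auto
    have F': "finite F'" "card F' \<le> S"
      using exec_memory_bound[OF ex'(1)] by auto
    have seg': "segment N p1" "segment N p2"
      using segment_append seg unfolding p by blast+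
    have "real (card (updates p1)) \<le> (s - 1/6) * real (charge p1)"
      using start_updates[OF s ex'(1) seg'(1)] c(1) r by simp
    moreover have "real (card (updates p2)) \<le> (s - 1/6) * real (charge p2)"
      by (rule phases_updates[OF s ex'(2) F' seg'(2) c(2)])
    moreover have "card (updates p) \<le> card (updates p1) + card (updates p2)"
      unfolding p by (simp add: card_Un_le)
    ultimately show ?thesis
      unfolding p by (simp add: distrib_left)
  qed
qed

section \<open>Exact counts of updates and forced transfers\<close>

lemma card_pairs_le: "2 * card {(i, j). 1 \<le> j \<and> j \<le> i \<and> i \<le> n} = n * (n + 1)"
proof -
  have "{(i, j). 1 \<le> j \<and> j \<le> i \<and> i \<le> n} = (SIGMA i:{1..n}. {1..i})"
    by auto
  then have "card {(i, j). 1 \<le> j \<and> j \<le> i \<and> i \<le> n} = (\<Sum>i=1..n. i)"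
    by simp
  then show ?thesis
    using gauss_sum_from_Suc_0[of n, where 'a = nat] by (simp add: algebra_simps)
qed

text \<open>The counted updates correspond to the 3-subsets of {1..N}. The real product also
  vanishes for N = 1 and N = 2.\<close>

lemma card_updates_schedule:
  assumes "chol_schedule N S p"
  shows "6 * real (card (updates p)) = real N * (real N - 1) * (real N - 2)"
proof -
  have "updates p = {(i, j, k). 1 \<le> k \<and> k < j \<and> j < i \<and> i \<le> N}"
  proof -
    have ops: "set (computed p) = chol_ops N"
      using assms by (simp add: chol_schedule_def)
    show ?thesis
      unfolding updates_def ops by (auto simp: chol_ops_def)
  qed
  moreover have "card {(i, j, k). 1 \<le> k \<and> k < j \<and> j < i \<and> i \<le> N}
      = (\<Sum>i=1..N. \<Sum>j=1..i-1. j - 1)"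
  proof -
    have "{(i, j, k). 1 \<le> k \<and> k < j \<and> j < i \<and> i \<le> N}
        = (SIGMA i:{1..N}. SIGMA j:{1..i-1}. {1..j-1})"
      by auto
    moreover have "card (SIGMA j:{1..m}. {1..j-1}) = (\<Sum>j=1..m. j - 1)" for m :: nat
      by (subst card_SigmaI) auto
    moreover have "card (SIGMA i:{1..N}. SIGMA j:{1..i-1}. {1..j-1})
        = (\<Sum>i=1..N. card (SIGMA j:{1..i-1}. {1..j-1}))"
      by (rule card_SigmaI) auto
    ultimately show ?thesis
      by (simp only:)
  qed
  moreover have "6 * real (\<Sum>i=1..n. \<Sum>j=1..i-1. j - 1) = real n * (real n - 1) * (real n - 2)" for n
  proof (induction n)
    case (Suc n)
    have "2 * real (\<Sum>j=1..m. j - 1) = real m * (real m - 1)" for m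
    proof (induction m)
      case (Suc m)
      have "2 * real (\<Sum>j=1..Suc m. j - 1) = 2 * real (\<Sum>j=1..m. j - 1) + 2 * real m"
        by simp
      also have "\<dots> = real (Suc m) * (real (Suc m) - 1)"
        unfolding Suc.IH by (simp add: algebra_simps)
      finally show ?case .
    qed simp
    from this[of n] have inner: "6 * real (\<Sum>j=1..n. j - 1) = 3 * (real n * (real n - 1))"
      by linarith
    have "6 * real (\<Sum>i=1..Suc n. \<Sum>j=1..i-1. j - 1)
        = 6 * real (\<Sum>i=1..n. \<Sum>j=1..i-1. j - 1) + 6 * real (\<Sum>j=1..n. j - 1)"
      by simp
    also have "\<dots> = real (Suc n) * (real (Suc n) - 1) * (real (Suc n) - 2)"
      unfolding Suc.IH inner by (simp add: algebra_simps)
    finally show ?case .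
  qed simp
  ultimately show ?thesis by (simp only:)
qed

text \<open>All N (N + 1) / 2 entries must be stored. Paying for the charged divisions leaves at
  least 2 N - 1 stores, and N diagonal loads are forced as well.\<close>

lemma io_count_ge_charge:
  assumes sched: "chol_schedule N S p" and "N > 0"
  shows "real (charge p) + 3 * real N - 1 \<le> real (io_count p)"
proof -
  obtain F where ex: "exec S ({}, {}) p (F, {})"
    using sched by (auto simp: chol_schedule_def)
  have ops: "set (computed p) = chol_ops N" and dist: "distinct (computed p)"
    using sched by (auto simp: chol_schedule_def)
  define off where "off = (\<lambda>x. case x of Load e \<Rightarrow> fst e \<noteq> snd e | _ \<Rightarrow> False)"
  define diag where "diag = (\<lambda>x. case x of Load e \<Rightarrow> fst e = snd e | _ \<Rightarrow> False)"
  define store where "store = (\<lambda>x. case x of Store e \<Rightarrow> True | _ \<Rightarrow> False)"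
  define late where "late = (\<lambda>a. case a of Div i k \<Rightarrow> 2 \<le> k | _ \<Rightarrow> False)"
  have io: "io_count p = length (filter off p) + length (filter diag p) + length (filter store p)"
    unfolding io_count_def
  proof (induction p)
    case (Cons x p)
    then show ?case
      by (cases x) (auto simp: off_def diag_def store_def)
  qed simp
  have "length (filter charged p) = length (filter off p) + length (filter late (computed p))"
  proof (induction p)
    case (Cons x p)
    then show ?case
      by (cases x rule: charged.cases) (auto simp: off_def late_def)
  qed simp
  then have ch: "charge p = length (filter off p) + length (filter late (computed p))"
    unfolding charge_def .
  have "length (filter late (computed p)) = card {a \<in> chol_ops N. late a}"
    using distinct_card[OF distinct_filter[OF dist, of late]] by (simp add: ops)
  \<comment> \<open>The shift turns 2 <= k < i <= N into a full triangle of side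
    \<open>N - 2\<close>; for N = 1 the truncated side 0 is still correct.\<close>
  also have "{a \<in> chol_ops N. late a}
      = (\<lambda>(i, j). Div (i + 2) (j + 1)) ` {(i, j). 1 \<le> j \<and> j \<le> i \<and> i \<le> N - 2}"
  proof (intro equalityI subsetI)
    fix a assume "a \<in> {a \<in> chol_ops N. late a}"
    then obtain i k where "a = Div i k" "2 \<le> k" "k < i" "i \<le> N"
      by (auto simp: chol_ops_def late_def)
    then show "a \<in> (\<lambda>(i, j). Div (i + 2) (j + 1)) ` {(i, j). 1 \<le> j \<and> j \<le> i \<and> i \<le> N - 2}"
      by (intro image_eqI[of _ _ "(i - 2, k - 1)"]) auto
  qed (auto simp: chol_ops_def late_def)
  also have "card \<dots> = card {(i, j). 1 \<le> j \<and> j \<le> i \<and> i \<le> N - 2}"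
    by (intro card_image) (auto simp: inj_on_def)
  finally have divs: "2 * length (filter late (computed p)) = (N - 2) * (N - 2 + 1)"
    using card_pairs_le[of "N - 2"] by simp
  have "(\<lambda>k. Load (k, k)) ` {1..N} \<subseteq> set (filter diag p)"
  proof clarify
    fix k assume "k \<in> {1..N}"
    then have "Sqrt k \<in> set (computed p)"
      by (auto simp: ops chol_ops_def)
    then show "Load (k, k) \<in> set (filter diag p)"
      using exec_operand_loaded[OF ex, of "Sqrt k" "(k, k)"] by (auto simp: diag_def)
  qed
  then have "card ((\<lambda>k. Load (k, k)) ` {1..N}) \<le> length (filter diag p)"
    by (meson List.finite_set card_length card_mono le_trans)
  then have diags: "N \<le> length (filter diag p)"
    by (simp add: card_image inj_on_def)
  have "Store ` {(i, j). 1 \<le> j \<and> j \<le> i \<and> i \<le> N} \<subseteq> set (filter store p)"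
  proof clarify
    fix i j :: nat assume ij: "1 \<le> j" "j \<le> i" "i \<le> N"
    have "(if i = j then Sqrt i else Div i j) \<in> set (computed p)"
      using ij by (auto simp: ops chol_ops_def)
    moreover have "target (if i = j then Sqrt i else Div i j) = (i, j)"
      by auto
    ultimately have "(i, j) \<in> target ` set (computed p)"
      by (metis image_eqI)
    then show "Store (i, j) \<in> set (filter store p)"
      using exec_target_stored[OF ex, of "(i, j)"] by (auto simp: store_def)
  qed
  then have "card (Store ` {(i, j). 1 \<le> j \<and> j \<le> i \<and> i \<le> N}) \<le> length (filter store p)"
    by (meson List.finite_set card_length card_mono le_trans)
  then have "card {(i, j). 1 \<le> j \<and> j \<le> i \<and> i \<le> N} \<le> length (filter store p)"
    by (simp add: card_image inj_on_def)
  then have stores: "N * (N + 1) \<le> 2 * length (filter store p)"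
    using card_pairs_le[of N] by linarith
  \<comment> \<open>Equality holds; N = 1 is separate because of the truncated subtraction.\<close>
  have "(N - 2) * (N - 2 + 1) + 4 * N \<le> N * (N + 1) + 2"
  proof (cases "N = 1")
    case False
    then obtain m where "N = m + 2"
      using \<open>N > 0\<close> by (metis One_nat_def Suc_leI add.commute le_Suc_ex le_neq_implies_less nat_1_add_1 plus_1_eq_Suc)
    then show ?thesis by (simp add: algebra_simps)
  qed simp
  then have "charge p + 3 * N \<le> io_count p + 1"
    unfolding io ch using divs diags stores by linarith
  then show ?thesis by linarith
qed

section \<open>Absorbing the lower-order terms\<close>

lemma final_quadratic:
  fixes s :: real
  assumes "N > 0" and s: "s \<ge> 7 / 10"
  shows "real N ^ 3 * (s - 1/6)
    \<le> s * (real N * (real N - 1) * (real N - 2) + 6 * (3 * real N - 1) * (s - 1/6))"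
proof -
  define n where "n = real N"
  define a b c where "a = 18 * n - 6" and "b = 3 * n^2 + n - 1" and "c = n ^ 3 / 6"
  have diff: "s * (n * (n - 1) * (n - 2) + 6 * (3 * n - 1) * (s - 1/6)) - n ^ 3 * (s - 1/6)
      = a * s^2 - b * s + c"
    by (simp add: a_def b_def c_def power2_eq_square power3_eq_cube field_simps)
  \<comment> \<open>For N = 1 and N = 2 the discriminant in \<open>s\<close> is positive, but
    \<open>s\<close> lies to the right of the roots. From N = 3 on it is negative.\<close>
  consider "N = 1" | "N = 2" | "N \<ge> 3"
    using \<open>N > 0\<close> by linarith
  then have "0 \<le> a * s^2 - b * s + c"
  proof cases
    case 1
    have "0 \<le> s * (12 * s - 3)"
      using s by simp
    then show ?thesis
      by (simp add: a_def b_def c_def n_def 1 power2_eq_square algebra_simps)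
  next
    case 2
    have "0 \<le> s * (30 * s - 13)"
      using s by simp
    then show ?thesis
      by (simp add: a_def b_def c_def n_def 2 power2_eq_square algebra_simps)
  next
    case 3
    \<comment> \<open>Centred at 3, the negated discriminant has only positive coefficients.\<close>
    define m where "m = n - 3"
    have m: "m \<ge> 0"
      using 3 by (simp add: m_def n_def)
    have "4 * a * c - b^2 = 3 * m^4 + 26 * m^3 + 77 * m^2 + 86 * m + 23"
      by (simp add: a_def b_def c_def m_def eval_nat_numeral algebra_simps)
    then have "0 \<le> (2 * a * s - b)^2 + (4 * a * c - b^2)"
      using m by simp
    also have "\<dots> = 4 * a * (a * s^2 - b * s + c)"
      by (simp add: power2_eq_square algebra_simps)
    finally have "0 \<le> 4 * a * (a * s^2 - b * s + c)" .
    moreover have "4 * a > 0"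
      using 3 by (simp add: a_def n_def)
    ultimately show ?thesis
      by (simp only: zero_le_mult_iff) linarith
  qed
  then show ?thesis
    using diff unfolding n_def by linarith
qed

lemma schedule_io_bound:
  assumes sched: "chol_schedule N S p" and "N > 0" "S > 0"
  shows "1 / (3 * sqrt 2) * (real N ^ 3 / sqrt (real S)) \<le> real (io_count p)"
proof -
  define s where "s = sqrt (real S / 2)"
  have S: "real S = 2 * s^2"
    by (simp add: s_def)
  \<comment> \<open>Since S >= 1, s^2 is at least 1/2 > 49/100.\<close>
  have "sqrt (49 / 100) \<le> s"
    unfolding s_def using \<open>S > 0\<close> by (intro real_sqrt_le_mono) auto
  also have "sqrt (49 / 100) = (7 / 10 :: real)"
    by (rule real_sqrt_unique) (auto simp: power2_eq_square)
  finally have s: "s \<ge> 7 / 10" .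
  let ?T = "real (charge p)" and ?n = "real N"
  have "?n * (?n - 1) * (?n - 2) \<le> 6 * ((s - 1/6) * ?T)"
    using schedule_updates[OF _ S sched] card_updates_schedule[OF sched] s by simp
  then have "?n * (?n - 1) * (?n - 2) + 6 * (3 * ?n - 1) * (s - 1/6)
      \<le> 6 * (s - 1/6) * (?T + 3 * ?n - 1)"
    by (simp add: algebra_simps)
  also have "\<dots> \<le> 6 * (s - 1/6) * real (io_count p)"
    using io_count_ge_charge[OF sched \<open>N > 0\<close>] s by (intro mult_left_mono) auto
  \<comment> \<open>The factor \<open>s\<close> prepares the comparison with N^3 (s - 1/6), after
    which the positive s - 1/6 cancels.\<close>
  finally have "s * (?n * (?n - 1) * (?n - 2) + 6 * (3 * ?n - 1) * (s - 1/6))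
      \<le> s * (6 * (s - 1/6) * real (io_count p))"
    using s by (intro mult_left_mono) auto
  with final_quadratic[OF \<open>N > 0\<close> s]
  have "?n ^ 3 * (s - 1/6) \<le> (6 * s * real (io_count p)) * (s - 1/6)"
    by (simp add: algebra_simps)
  then have "?n ^ 3 \<le> 6 * s * real (io_count p)"
    using s by (simp add: mult_le_cancel_right)
  moreover have "6 * s = 3 * sqrt 2 * sqrt (real S)"
    by (simp add: s_def real_sqrt_divide field_simps)
  ultimately have "?n ^ 3 \<le> (3 * sqrt 2 * sqrt (real S)) * real (io_count p)"
    by simp
  moreover have "0 < 3 * sqrt 2 * sqrt (real S)"
    using \<open>S > 0\<close> by simp
  ultimately show ?thesis
    by (simp add: pos_divide_le_eq mult.commute)
qed

theorem corollary4p8: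
  fixes N S :: nat
  assumes "N > 0" and "S > 0"
  shows "ereal_of_enat (Q_Chol N S) \<ge> ereal (1 / (3 * sqrt 2) * (real N ^ 3 / sqrt (real S)))"
proof (cases "{p. chol_schedule N S p} = {}")
  \<comment> \<open>The infimum over no schedules is infinite.\<close>
  case True
  then show ?thesis
    by (simp add: Q_Chol_def top_enat_def)
next
  case False
  then obtain p0 where "chol_schedule N S p0"
    by auto
  \<comment> \<open>By well-ordering of the extended naturals, the infimum is attained by a
    schedule.\<close>
  then have "Q_Chol N S \<in> (\<lambda>p. enat (io_count p)) ` {p. chol_schedule N S p}"
    unfolding Q_Chol_def by (intro wellorder_InfI[of "enat (io_count p0)"]) simp
  then show ?thesis
    using schedule_io_bound assms by auto
qed

end
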